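(* Let $n\geq 1$ and $R=\mathbb{Z}[t^{\pm 1}]$. The unreduced Burau representation $\mathbf{B}_n\to \mathrm{GL}_n(R)$ and the reduced Burau representation $\mathbf{B}_n\to \mathrm{GL}_{n-1}(R)$ extend, along the inclusion $\mathbf{B}_n\hookrightarrow \mathbf{LB}_n$ sending the $i$-th standard generator of $\mathbf{B}_n$ to $\sigma_i$, to $R$-linear actions of the loop braid group $\mathbf{LB}_n$ on $R^{\oplus n}$ and on $R^{\oplus n-1}$ respectively. Explicitly: (1) There is a homomorphism $\mathbf{LB}_n\to \mathrm{GL}_n(R)$ given, for $1\leq i\leq n-1$, by $$\tau_i\longmapsto I_{i-1}\oplus\begin{bmatrix}0&1\\1&0\end{bmatrix}\oplus I_{n-i-1},\qquad \sigma_i\longmapsto I_{i-1}\oplus\begin{bmatrix}1-t&1\\t&0\end{bmatrix}\oplus I_{n-i-1},$$ and its restriction to $\mathbf{B}_n$ is the unreduced Burau representation. (2) There is a homomorphism $\mathbf{LB}_n\to \mathrm{GL}_{n-1}(R)$ given, for $1\leq i\leq n-1$, by $$\tau_i\longmapsto I_{i-2}\oplus\begin{bmatrix}1&0&0\\1&-1&1\\0&0&1\end{bmatrix}\oplus I_{n-i-2},\qquad \sigma_i\longmapsto I_{i-2}\oplus\begin{bmatrix}1&0&0\\t&-t&1\\0&0&1\end{bmatrix}\oplus I_{n-i-2},$$ and its restriction to $\mathbf{B}_n$ is the reduced Burau representation. Here, if $i=1$ one ignores the block $I_{-1}$ on the left and removes the left column and top row of the displayed $3\times 3$ matrix, and if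 $i=n-1$ one ignores the block $I_{-1}$ on the right and removes the right column and bottom row (both, if $n=2$).
   Context: Loop braid groups. Let $\mathbb{D}^3$ be the closed unit ball in $\mathbb{R}^3$ and $U_n$ a fixed oriented trivial $n$-component link in its interior. Let $\mathrm{Emb}^u(U_n,\mathbb{D}^3)$ be the path-component of the inclusion in the space of smooth embeddings of $U_n$ into the interior of $\mathbb{D}^3$ (smooth Whitney topology). Put $\mathcal{E}^+(U_n,\mathbb{D}^3)=\mathrm{Emb}^u(U_n,\mathbb{D}^3)/\mathrm{Diff}^+(U_n)$, where $\mathrm{Diff}^+$ means orientation-preserving diffeomorphisms. The loop braid group is $\mathbf{LB}_n=\pi_1(\mathcal{E}^+(U_n,\mathbb{D}^3))$. Take the basepoint to be $n$ circles in the $xy$-plane arranged in a row from left to right. $\mathbf{LB}_n$ is generated by $\tau_1,\dots,\tau_{n-1},\sigma_1,\dots,\sigma_{n-1}$. Both $\tau_i$ and $\sigma_i$ exchange the $i$-th and $(i+1)$-st circles and leave the others fixed; for $\tau_i$ no circle passes through the other, and for $\sigma_i$ the $i$-th circle passes through the $(i+1)$-st. $\mathbf{LB}_n$ is also the group of isotopy classes of diffeomorphisms of $\mathbb{D}^3$, equal to the identity near $\partial\mathbb{D}^3$, preserving $U_n$ and its orientation. It thus acts on $\pi_1(\mathbb{D}^3\smallsetminus U_n)=F_n=\langle a_1,\dots,a_n\rangle$, where $a_j$ is a loop going once through the $j$-th circle. It is standard that this action is faithful, so $\mathbf{LB}_n$ may be viewed as the subgroup of $\mathrm{Aut}(F_n)$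 generated by $\tau_i:\ a_i\mapsto a_{i+1},\ a_{i+1}\mapsto a_i$ and $\sigma_i:\ a_i\mapsto a_ia_{i+1}a_i^{-1},\ a_{i+1}\mapsto a_i$ (fixing all other $a_j$). Products are composed from right to left, as functions. Classical braid group. $\mathbf{B}_n=\pi_1(C_n(\mathbb{R}^2))$, the fundamental group of the configuration space of $n$ unordered points in the plane, with standard (Artin) generators indexed by $1\le i\le n-1$. The homomorphism $\mathbf{B}_n\to\mathbf{LB}_n$ sending the $i$-th standard generator to $\sigma_i$ is injective. Classical Burau representations. The unreduced Burau representation $\mathbf{B}_n\to\mathrm{GL}_n(\mathbb{Z}[t^{\pm1}])$ sends the $i$-th standard generator to $I_{i-1}\oplus\begin{bmatrix}1-t&1\\t&0\end{bmatrix}\oplus I_{n-i-1}$. The reduced Burau representation $\mathbf{B}_n\to\mathrm{GL}_{n-1}(\mathbb{Z}[t^{\pm1}])$ sends it to $I_{i-2}\oplus\begin{bmatrix}1&0&0\\t&-t&1\\0&0&1\end{bmatrix}\oplus I_{n-i-2}$, with the same convention for $i=1$ and $i=n-1$ (remove left column/top row, resp. right column/bottom row). Matrices act on column vectors. *)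

theory Defs
  imports
    "HOL-Analysis.Homotopy"
    "HOL-Algebra.Bij"
    "HOL-Algebra.Generated_Groups"
    "HOL-Library.Poly_Mapping"
    "Jordan_Normal_Form.Determinant"
begin

definition loops_at :: "'a topology \<Rightarrow> 'a \<Rightarrow> (real \<Rightarrow> 'a) set" where
  "loops_at X x = {p. pathin X p \<and> p 0 = x \<and> p 1 = x}"

definition loop_homotopy_rel :: "'a topology \<Rightarrow> 'a \<Rightarrow> ((real \<Rightarrow> 'a) \<times> (real \<Rightarrow> 'a)) set" where
  "loop_homotopy_rel X x =
     {(p, q). p \<in> loops_at X x \<and> q \<in> loops_at X x \<and>
        homotopic_with (\<lambda>h. h 0 = x \<and> h 1 = x) (top_of_set {0..1}) X p q}"

text \<open>The library's \<open>joinpaths\<close> requires its codomain to be in a topological type class.\<close>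

definition concat_loops :: "(real \<Rightarrow> 'a) \<Rightarrow> (real \<Rightarrow> 'a) \<Rightarrow> real \<Rightarrow> 'a" where
  "concat_loops p q = (\<lambda>s. if s \<le> 1/2 then p (2 * s) else q (2 * s - 1))"

definition loop_class :: "'a topology \<Rightarrow> 'a \<Rightarrow> (real \<Rightarrow> 'a) \<Rightarrow> (real \<Rightarrow> 'a) set" where
  "loop_class X x p = loop_homotopy_rel X x `` {p}"

definition fundamental_group :: "'a topology \<Rightarrow> 'a \<Rightarrow> (real \<Rightarrow> 'a) set monoid" where
  "fundamental_group X x =
     \<lparr>carrier = loops_at X x // loop_homotopy_rel X x,
      monoid.mult = (\<lambda>P Q. \<Union>p\<in>P. \<Union>q\<in>Q. loop_class X x (concat_loops p q)),
      one = loop_class X x (\<lambda>_. x)\<rparr>"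

definition quotient_topology :: "'a topology \<Rightarrow> ('a \<Rightarrow> 'b) \<Rightarrow> 'b topology" where
  "quotient_topology X q =
     topology (\<lambda>U. U \<subseteq> q ` topspace X \<and> openin X {x \<in> topspace X. q x \<in> U})"

lemma openin_quotient_topology:
  "openin (quotient_topology X q) U \<longleftrightarrow>
     U \<subseteq> q ` topspace X \<and> openin X {x \<in> topspace X. q x \<in> U}"
proof -
  have "istopology (\<lambda>U. U \<subseteq> q ` topspace X \<and> openin X {x \<in> topspace X. q x \<in> U})"
    unfolding istopology_def
  proof (intro conjI allI impI)
    fix S T
    assume "S \<subseteq> q ` topspace X \<and> openin X {x \<in> topspace X. q x \<in> S}"
      and "T \<subseteq> q ` topspace X \<and> openin X {x \<in> topspace X. q x \<in> T}"
    moreover have "{x \<in> topspace X. q x \<in> S \<inter> T} =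
        {x \<in> topspace X. q x \<in> S} \<inter> {x \<in> topspace X. q x \<in> T}"
      by blast
    ultimately show "S \<inter> T \<subseteq> q ` topspace X" "openin X {x \<in> topspace X. q x \<in> S \<inter> T}"
      by auto
  next
    fix K
    assume K: "\<forall>S\<in>K. S \<subseteq> q ` topspace X \<and> openin X {x \<in> topspace X. q x \<in> S}"
    then show "\<Union>K \<subseteq> q ` topspace X"
      by blast
    have "{x \<in> topspace X. q x \<in> \<Union>K} = (\<Union>S\<in>K. {x \<in> topspace X. q x \<in> S})"
      by blast
    with K show "openin X {x \<in> topspace X. q x \<in> \<Union>K}"
      by (simp add: openin_clauses)
  qed
  then show ?thesis
    by (simp add: quotient_topology_def)
qed

lemma quotient_map_quotient_topology: "quotient_map X (quotient_topology X q) q"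
proof -
  have "topspace (quotient_topology X q) = q ` topspace X"
  proof
    show "topspace (quotient_topology X q) \<subseteq> q ` topspace X"
      using openin_quotient_topology[of X q] openin_topspace by blast
    have "{x \<in> topspace X. q x \<in> q ` topspace X} = topspace X"
      by blast
    then have "openin (quotient_topology X q) (q ` topspace X)"
      by (simp add: openin_quotient_topology)
    then show "q ` topspace X \<subseteq> topspace (quotient_topology X q)"
      by (rule openin_subset)
  qed
  then show ?thesis
    by (auto simp: quotient_map_def openin_quotient_topology)
qed

definition ordered_config :: "nat \<Rightarrow> (nat \<Rightarrow> real \<times> real) topology" where
  "ordered_config n =
     subtopology (product_topology (\<lambda>_. euclidean) {1..n}) {c. inj_on c {1..n}}"

definition unordered_config :: "nat \<Rightarrow> (real \<times> real) set topology" where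
  "unordered_config n = quotient_topology (ordered_config n) (\<lambda>c. c ` {1..n})"

definition base_config :: "nat \<Rightarrow> (real \<times> real) set" where
  "base_config n = (\<lambda>j. (real j, 0)) ` {1..n}"

definition braid_group :: "nat \<Rightarrow> (real \<Rightarrow> (real \<times> real) set) set monoid" where
  "braid_group n = fundamental_group (unordered_config n) (base_config n)"

text \<open>
  The standard generators are half twists: the points \<open>(i, 0)\<close> and \<open>(i + 1, 0)\<close> are exchanged by
  rotating them counterclockwise by \<open>\<pi>\<close> about their midpoint. Neither the sense of rotation
  nor the order of concatenation in the fundamental group matters for the inclusion into the loop
  braid group: reflecting the plane is an automorphism inverting every generator, and inversion is
  an isomorphism onto the opposite group.
\<close>

definition artin_loop :: "nat \<Rightarrow> nat \<Rightarrow> real \<Rightarrow> (real \<times> real) set" where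
  "artin_loop n i s =
     (\<lambda>j. (real j, 0)) ` ({1..n} - {i, i + 1}) \<union>
     {(real i + 1/2 - cos (pi * s) / 2, - sin (pi * s) / 2),
      (real i + 1/2 + cos (pi * s) / 2, sin (pi * s) / 2)}"

definition artin_generator :: "nat \<Rightarrow> nat \<Rightarrow> (real \<Rightarrow> (real \<times> real) set) set" where
  "artin_generator n i = loop_class (unordered_config n) (base_config n) (artin_loop n i)"

text \<open>
  Elements are freely reduced words; the letter \<open>(j, True)\<close> stands for the generator \<open>a\<^sub>j\<close> and
  \<open>(j, False)\<close> for its inverse.
\<close>

type_synonym word = "(nat \<times> bool) list"

definition letter_inv :: "nat \<times> bool \<Rightarrow> nat \<times> bool" where
  "letter_inv x = (fst x, \<not> snd x)"

definition reduced :: "word \<Rightarrow> bool" where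
  "reduced w \<longleftrightarrow> successively (\<lambda>x y. y \<noteq> letter_inv x) w"

fun cons_reduce :: "nat \<times> bool \<Rightarrow> word \<Rightarrow> word" where
  "cons_reduce x [] = [x]"
| "cons_reduce x (y # w) = (if y = letter_inv x then w else x # y # w)"

definition free_group :: "nat \<Rightarrow> word monoid" where
  "free_group n =
     \<lparr>carrier = {w. reduced w \<and> fst ` set w \<subseteq> {1..n}},
      monoid.mult = (\<lambda>u v. foldr cons_reduce u v),
      one = []\<rparr>"

definition free_gen :: "nat \<Rightarrow> word" where
  "free_gen j = [(j, True)]"

definition free_lift :: "('a, 'b) monoid_scheme \<Rightarrow> (nat \<Rightarrow> 'a) \<Rightarrow> word \<Rightarrow> 'a" where
  "free_lift G f w =
     foldr (\<lambda>(j, e) g. (if e then f j else inv\<^bsub>G\<^esub> (f j)) \<otimes>\<^bsub>G\<^esub> g) w \<one>\<^bsub>G\<^esub>"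

definition free_endo :: "nat \<Rightarrow> (nat \<Rightarrow> word) \<Rightarrow> word \<Rightarrow> word" where
  "free_endo n f = restrict (free_lift (free_group n) f) (carrier (free_group n))"

text \<open>
  The loop braid group, the fundamental group of the space of unparametrised oriented trivial
  \<open>n\<close>-component links in the ball, acts faithfully on the free fundamental group of the complement
  of the base link. It is identified here with its image in the automorphism group; products there
  are compositions of functions, from right to left.
\<close>

definition lb_tau :: "nat \<Rightarrow> nat \<Rightarrow> word \<Rightarrow> word" where
  "lb_tau n i = free_endo n (free_gen(i := free_gen (i + 1), i + 1 := free_gen i))"

definition lb_sigma :: "nat \<Rightarrow> nat \<Rightarrow> word \<Rightarrow> word" where
  "lb_sigma n i = free_endo n
     (free_gen(i := free_gen i \<otimes>\<^bsub>free_group n\<^esub> free_gen (i + 1) \<otimes>\<^bsub>free_group n\<^esub>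
                    inv\<^bsub>free_group n\<^esub> (free_gen i),
               i + 1 := free_gen i))"

definition loop_braid_group :: "nat \<Rightarrow> (word \<Rightarrow> word) monoid" where
  "loop_braid_group n =
     subgroup_generated (AutoGroup (free_group n)) (lb_tau n ` {1..<n} \<union> lb_sigma n ` {1..<n})"

text \<open>
  \<open>\<int>[t\<^sup>\<plusminus>\<^sup>1]\<close> as the group ring of \<open>\<int>\<close>: an element is a finitely supported map sending each
  exponent to its coefficient, with convolution as multiplication.
\<close>

type_synonym laurent = "int \<Rightarrow>\<^sub>0 int"

definition tvar :: laurent where
  "tvar = Poly_Mapping.single 1 1"

definition GL :: "nat \<Rightarrow> laurent mat monoid" where
  "GL n = units_of (ring_mat TYPE(laurent) n ())"

definition block_2 :: "nat \<Rightarrow> nat \<Rightarrow> laurent mat \<Rightarrow> laurent mat" where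
  "block_2 n i A = diag_block_mat [1\<^sub>m (i - 1), A, 1\<^sub>m (n - i - 1)]"

text \<open>
  The \<open>(n - 1) \<times> (n - 1)\<close> matrix \<open>I\<^bsub>i-2\<^esub> \<oplus> A \<oplus> I\<^bsub>n-i-2\<^esub>\<close> for a \<open>3 \<times> 3\<close> matrix \<open>A\<close>, which is truncated
  at the ends. Where an index would be \<open>-1\<close>, truncated subtraction gives an identity block of
  size 0. Rows and columns of \<open>A\<close> are counted from 0 in \<open>mat_delete\<close>.
\<close>

definition block_3 :: "nat \<Rightarrow> nat \<Rightarrow> laurent mat \<Rightarrow> laurent mat" where
  "block_3 n i A =
     (let B = (if i = n - 1 then mat_delete A 2 2 else A);
          C = (if i = 1 then mat_delete B 0 0 else B)
      in diag_block_mat [1\<^sub>m (i - 2), C, 1\<^sub>m (n - i - 2)])"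

definition unreduced_tau :: "nat \<Rightarrow> nat \<Rightarrow> laurent mat" where
  "unreduced_tau n i = block_2 n i (mat_of_rows_list 2
     [[0, 1],
      [1, 0]])"

definition unreduced_sigma :: "nat \<Rightarrow> nat \<Rightarrow> laurent mat" where
  "unreduced_sigma n i = block_2 n i (mat_of_rows_list 2
     [[1 - tvar, 1],
      [tvar,     0]])"

definition reduced_tau :: "nat \<Rightarrow> nat \<Rightarrow> laurent mat" where
  "reduced_tau n i = block_3 n i (mat_of_rows_list 3
     [[1,  0, 0],
      [1, -1, 1],
      [0,  0, 1]])"

definition reduced_sigma :: "nat \<Rightarrow> nat \<Rightarrow> laurent mat" where
  "reduced_sigma n i = block_3 n i (mat_of_rows_list 3
     [[1,         0, 0],
      [tvar, - tvar, 1],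
      [0,         0, 1]])"

definition is_unreduced_burau ::
    "nat \<Rightarrow> ((real \<Rightarrow> (real \<times> real) set) set \<Rightarrow> laurent mat) \<Rightarrow> bool" where
  "is_unreduced_burau n \<beta> \<longleftrightarrow>
     \<beta> \<in> hom (braid_group n) (GL n) \<and>
     (\<forall>i\<in>{1..<n}. \<beta> (artin_generator n i) = unreduced_sigma n i)"

definition is_reduced_burau ::
    "nat \<Rightarrow> ((real \<Rightarrow> (real \<times> real) set) set \<Rightarrow> laurent mat) \<Rightarrow> bool" where
  "is_reduced_burau n \<beta> \<longleftrightarrow>
     \<beta> \<in> hom (braid_group n) (GL (n - 1)) \<and>
     (\<forall>i\<in>{1..<n}. \<beta> (artin_generator n i) = reduced_sigma n i)"

definition is_braid_inclusion ::
    "nat \<Rightarrow> ((real \<Rightarrow> (real \<times> real) set) set \<Rightarrow> word \<Rightarrow> word) \<Rightarrow> bool" where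
  "is_braid_inclusion n \<iota> \<longleftrightarrow>
     \<iota> \<in> mon (braid_group n) (loop_braid_group n) \<and>
     (\<forall>i\<in>{1..<n}. \<iota> (artin_generator n i) = lb_sigma n i)"

end

theory Submission
  imports Defs
begin

text \<open>
  Both representations come from Fox calculus. Evaluate the Fox derivatives \<open>\<partial>w / \<partial>a\<^sub>k\<close> of words in
  \<open>F\<^sub>n\<close> at \<open>a\<^sub>1 = \<dots> = a\<^sub>n = t\<close>. An automorphism \<open>\<phi>\<close> has a Jacobian matrix \<open>J(\<phi>)\<close>, whose \<open>j\<close>-th column
  consists of the derivatives of \<open>\<phi>(a\<^sub>j)\<close>. In general the chain rule for
  \<open>\<phi>\<psi>\<close> involves the derivatives of \<open>\<psi>\<close> only after \<open>\<phi>\<close> is applied to them. However, \<open>\<tau>\<^sub>i\<close> and \<open>\<sigma>\<^sub>i\<close>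
  send generators to conjugates of generators, so every element of the loop braid group preserves
  the total exponent of words (\<open>weight_auto\<close>, \<open>carrier_loop_braid_group\<close>). For such \<open>\<phi>\<close> the twist by \<open>\<phi>\<close> disappears after evaluation at \<open>t\<close>, and
  \<open>J\<close> is multiplicative (\<open>weight_preserving_hom\<close>, \<open>fox_jacobian_mult\<close>). The product rule gives
  \<open>a\<^sub>i a\<^bsub>i+1\<^esub> a\<^sub>i\<^sup>-\<^sup>1\<close> the derivatives \<open>1 - t\<close> and \<open>t\<close>, so that \<open>J(\<sigma>\<^sub>i)\<close> is the unreduced Burau matrix and
  \<open>J(\<tau>\<^sub>i)\<close> is a permutation matrix.

  By Fox's fundamental formula (\<open>sum_fox\<close>) the columns of \<open>J(\<phi>)\<close> have sum 1
  (\<open>fox_jacobian_col_sum\<close>). Thus \<open>J(\<phi>)\<close> preserves the submodule of vectors with coordinate sum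
  0. Written in the basis \<open>e\<^sub>j - e\<^bsub>j+1\<^esub>\<close> of this submodule, the restricted action is the reduced Burau
  representation (\<open>reduced_jacobian_mult\<close>, \<open>reduced_jacobian_exchange\<close>).

  A homomorphism from the braid group that sends the standard generators to the \<open>\<sigma>\<^sub>i\<close> becomes a Burau
  representation when it is composed with either of the two.
\<close>

section \<open>The free group of reduced words\<close>

lemma fst_letter_inv [simp]: "fst (letter_inv x) = fst x"
  by (simp add: letter_inv_def)

lemma letter_inv_letter_inv [simp]: "letter_inv (letter_inv x) = x"
  by (simp add: letter_inv_def)

lemma reduced_Nil [simp]: "reduced []"
  by (simp add: reduced_def)

lemma reduced_Cons: "reduced (x # w) \<longleftrightarrow> reduced w \<and> (w = [] \<or> hd w \<noteq> letter_inv x)"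
  by (cases w) (auto simp: reduced_def)

lemma reduced_cons_reduce: "reduced w \<Longrightarrow> reduced (cons_reduce x w)"
  by (cases w) (auto simp: reduced_Cons)

lemma reduced_foldr: "reduced v \<Longrightarrow> reduced (foldr cons_reduce u v)"
  by (induction u) (auto intro: reduced_cons_reduce)

lemma foldr_cons_reduce_Nil: "reduced w \<Longrightarrow> foldr cons_reduce w [] = w"
proof (induction w)
  case (Cons x w)
  then show ?case
    by (cases w) (auto simp: reduced_Cons)
qed simp

lemma cons_reduce_cancel: 
  assumes "reduced w"
  shows "cons_reduce x (cons_reduce (letter_inv x) w) = w"
proof (cases w)
  case (Cons y v)
  with assms show ?thesis
    by (cases v) (auto simp: reduced_Cons)
qed simp

lemma foldr_cons_reduce:
  "reduced w \<Longrightarrow> foldr cons_reduce (cons_reduce x v) w = cons_reduce x (foldr cons_reduce v w)"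
  by (cases v) (auto simp: cons_reduce_cancel reduced_foldr)

text \<open>
  A word acts on the reduced words by successive multiplication by its letters, and the action
  of a word does not change when the word is reduced. This is associativity.
\<close>

lemma foldr_cons_reduce_assoc:
  "reduced w \<Longrightarrow>
    foldr cons_reduce (foldr cons_reduce u v) w = foldr cons_reduce u (foldr cons_reduce v w)"
  by (induction u) (auto simp: foldr_cons_reduce)

lemma foldr_cons_reduce_inverse:
  "reduced w \<Longrightarrow> foldr cons_reduce (map letter_inv (rev u)) (foldr cons_reduce u w) = w"
proof (induction u)
  case (Cons x u)
  then show ?case
    using cons_reduce_cancel[of "foldr cons_reduce u w" "letter_inv x"] by (simp add: reduced_foldr)
qed simp

lemma letters_cons_reduce: "fst ` set (cons_reduce x w) \<subseteq> insert (fst x) (fst ` set w)"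
  by (cases w) auto

lemma letters_foldr: "fst ` set (foldr cons_reduce u v) \<subseteq> fst ` set u \<union> fst ` set v"
proof (induction u)
  case (Cons x u)
  have "fst ` set (foldr cons_reduce (x # u) v) \<subseteq> insert (fst x) (fst ` set (foldr cons_reduce u v))"
    using letters_cons_reduce by simp
  with Cons show ?case
    by (simp; blast)
qed simp

lemma carrier_free_group: "w \<in> carrier (free_group n) \<longleftrightarrow> reduced w \<and> fst ` set w \<subseteq> {1..n}"
  by (simp add: free_group_def)

lemma mult_free_group: "u \<otimes>\<^bsub>free_group n\<^esub> v = foldr cons_reduce u v"
  by (simp add: free_group_def)

lemma one_free_group: "\<one>\<^bsub>free_group n\<^esub> = []"
  by (simp add: free_group_def)

lemma group_free_group: "group (free_group n)"
proof (rule groupI)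
  fix u v
  assume "u \<in> carrier (free_group n)" "v \<in> carrier (free_group n)"
  then show "u \<otimes>\<^bsub>free_group n\<^esub> v \<in> carrier (free_group n)"
    using letters_foldr[of u v] unfolding carrier_free_group mult_free_group
    by (blast intro: reduced_foldr)
next
  fix u
  assume u: "u \<in> carrier (free_group n)"
  let ?v = "foldr cons_reduce (map letter_inv (rev u)) []"
  have "?v \<in> carrier (free_group n)"
    using u letters_foldr[of "map letter_inv (rev u)" "[]"]
    by (force simp: carrier_free_group reduced_foldr)
  moreover have "?v \<otimes>\<^bsub>free_group n\<^esub> u = \<one>\<^bsub>free_group n\<^esub>"
    using u foldr_cons_reduce_inverse[of "[]" u]
    by (simp add: carrier_free_group mult_free_group one_free_group foldr_cons_reduce_assoc
        foldr_cons_reduce_Nil)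
  ultimately show "\<exists>v\<in>carrier (free_group n). v \<otimes>\<^bsub>free_group n\<^esub> u = \<one>\<^bsub>free_group n\<^esub>"
    by blast
qed (auto simp: carrier_free_group mult_free_group one_free_group foldr_cons_reduce_assoc)

lemma free_gen_carrier: "j \<in> {1..n} \<Longrightarrow> free_gen j \<in> carrier (free_group n)"
  by (simp add: free_gen_def carrier_free_group reduced_Cons)

lemma inv_free_gen:
  assumes "j \<in> {1..n}"
  shows "inv\<^bsub>free_group n\<^esub> (free_gen j) = [(j, False)]"
proof (rule group.inv_equality[OF group_free_group])
  show "[(j, False)] \<otimes>\<^bsub>free_group n\<^esub> free_gen j = \<one>\<^bsub>free_group n\<^esub>"
    by (simp add: mult_free_group one_free_group free_gen_def letter_inv_def)
  show "[(j, False)] \<in> carrier (free_group n)"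
    using assms by (simp add: carrier_free_group reduced_Cons)
qed (use assms in \<open>rule free_gen_carrier\<close>)

lemma Cons_free_group:
  assumes "x # w \<in> carrier (free_group n)"
  shows "x # w = [x] \<otimes>\<^bsub>free_group n\<^esub> w" "[x] \<in> carrier (free_group n)" "w \<in> carrier (free_group n)"
  using assms by (cases w; auto simp: carrier_free_group mult_free_group reduced_Cons)+

lemma free_endo_gen:
  assumes "j \<in> {1..n}" and "f j \<in> carrier (free_group n)"
  shows "free_endo n f (free_gen j) = f j"
proof -
  have "free_lift (free_group n) f (free_gen j) = f j \<otimes>\<^bsub>free_group n\<^esub> \<one>\<^bsub>free_group n\<^esub>"
    by (simp add: free_lift_def free_gen_def)
  also have "\<dots> = f j"
    using assms group_free_group by (simp add: group.is_monoid)
  finally show ?thesis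
    by (simp add: free_endo_def free_gen_carrier[OF assms(1)])
qed

section \<open>Fox derivatives\<close>

definition tinv :: laurent where
  "tinv = Poly_Mapping.single (- 1) 1"

lemma tvar_tinv: "tvar * tinv = 1"
  by (simp add: tvar_def tinv_def mult_single)

lemma tvar_tinv_cancel: "tvar * (tinv * x) = x" "tinv * (tvar * x) = x"
  by (simp_all add: mult.assoc[symmetric] tvar_tinv mult.commute[of tinv tvar])

lemma tvar_neq_1: "tvar \<noteq> 1"
proof
  assume "tvar = 1"
  then have "Poly_Mapping.lookup tvar 1 = Poly_Mapping.lookup (1 :: laurent) 1"
    by simp
  then show False
    by (simp add: tvar_def lookup_one)
qed

definition letter_weight :: "nat \<times> bool \<Rightarrow> laurent" where
  "letter_weight x = (if snd x then tvar else tinv)"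

text \<open>
  The value of a word at \<open>a\<^sub>1 = \<dots> = a\<^sub>n = t\<close>, which is \<open>t\<close> to the power of its total exponent.
\<close>

definition weight :: "word \<Rightarrow> laurent" where
  "weight w = prod_list (map letter_weight w)"

definition letter_fox :: "nat \<times> bool \<Rightarrow> nat \<Rightarrow> laurent" where
  "letter_fox x k = (if k = fst x then if snd x then 1 else - tinv else 0)"

text \<open>
  The Fox derivative \<open>\<partial>w / \<partial>a\<^sub>k\<close>, with every generator of the free group evaluated at \<open>t\<close>.
\<close>

fun fox :: "word \<Rightarrow> nat \<Rightarrow> laurent" where
  "fox [] k = 0"
| "fox (x # w) k = letter_fox x k + letter_weight x * fox w k"

lemma weight_Nil [simp]: "weight [] = 1"
  and weight_Cons [simp]: "weight (x # w) = letter_weight x * weight w"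
  by (simp_all add: weight_def)

lemma letter_weight_inv: "letter_weight x * letter_weight (letter_inv x) = 1"
  by (simp add: letter_weight_def letter_inv_def tvar_tinv mult.commute[of tinv tvar])

lemma letter_fox_inv: "letter_fox x k + letter_weight x * letter_fox (letter_inv x) k = 0"
  by (simp add: letter_weight_def letter_inv_def letter_fox_def tvar_tinv)

lemma weight_cons_reduce: "weight (cons_reduce x w) = letter_weight x * weight w"
  by (cases w) (simp_all add: mult.assoc[symmetric] letter_weight_inv)

lemma fox_cons_reduce: "fox (cons_reduce x w) k = letter_fox x k + letter_weight x * fox w k"
proof (cases w)
  case (Cons y v)
  have "letter_fox x k + letter_weight x * (letter_fox (letter_inv x) k +
      letter_weight (letter_inv x) * fox v k) = fox v k"
    using letter_fox_inv[of x k] letter_weight_inv[of x]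
    by (simp add: distrib_left mult.assoc[symmetric] add.assoc[symmetric])
  then show ?thesis
    by (auto simp: Cons)
qed simp

lemma weight_mult: "weight (u \<otimes>\<^bsub>free_group n\<^esub> v) = weight u * weight v"
  unfolding mult_free_group by (induction u) (simp_all add: weight_cons_reduce mult.assoc)

text \<open>
  This is the product rule. It holds because the derivative of a word does not change when a
  letter is cancelled against its inverse.
\<close>

lemma fox_mult: "fox (u \<otimes>\<^bsub>free_group n\<^esub> v) k = fox u k + weight u * fox v k"
  unfolding mult_free_group by (induction u) (simp_all add: fox_cons_reduce algebra_simps)

lemma weight_free_gen [simp]: "weight (free_gen j) = tvar"
  by (simp add: free_gen_def letter_weight_def)

lemma fox_free_gen [simp]: "fox (free_gen j) k = (if k = j then 1 else 0)"
  by (simp add: free_gen_def letter_fox_def)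

text \<open>
  This is Fox's fundamental formula \<open>w - 1 = \<Sum>\<^sub>k (\<partial>w / \<partial>a\<^sub>k) (a\<^sub>k - 1)\<close> after evaluation at \<open>t\<close>.
\<close>

lemma sum_fox:
  assumes "fst ` set w \<subseteq> {1..n}"
  shows "(\<Sum>k = 1..n. fox w k) * (tvar - 1) = weight w - 1"
  using assms
proof (induction w)
  case (Cons x w)
  have "(\<Sum>k = 1..n. letter_fox x k) * (tvar - 1) = letter_weight x - 1"
    using Cons.prems tvar_tinv
    by (simp add: letter_fox_def letter_weight_def sum.delta' algebra_simps)
  moreover have "(\<Sum>k = 1..n. fox (x # w) k) =
      (\<Sum>k = 1..n. letter_fox x k) + letter_weight x * (\<Sum>k = 1..n. fox w k)"
    by (simp add: sum.distrib sum_distrib_left)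
  ultimately have "(\<Sum>k = 1..n. fox (x # w) k) * (tvar - 1) =
      letter_weight x - 1 + letter_weight x * ((\<Sum>k = 1..n. fox w k) * (tvar - 1))"
    by (simp add: distrib_right mult.assoc)
  also have "(\<Sum>k = 1..n. fox w k) * (tvar - 1) = weight w - 1"
    using Cons by simp
  finally show ?case
    by (simp add: right_diff_distrib)
qed simp

section \<open>Automorphisms preserving the total exponent\<close>

text \<open>
  The automorphisms whose Jacobian needs no twist in the chain rule. It is convenient to work with
  this whole subgroup, because membership is inherited by inverses and can be tested on the
  generators of the free group.
\<close>

definition weight_auto :: "nat \<Rightarrow> (word \<Rightarrow> word) set" where
  "weight_auto n = {\<phi> \<in> auto (free_group n).
     \<forall>w\<in>carrier (free_group n). weight (\<phi> w) = weight w}"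

lemma carrier_AutoGroup: "carrier (AutoGroup G) = auto G"
  by (simp add: AutoGroup_def)

lemma mult_AutoGroup:
  assumes "\<phi> \<in> auto G" "\<psi> \<in> auto G" "x \<in> carrier G"
  shows "(\<phi> \<otimes>\<^bsub>AutoGroup G\<^esub> \<psi>) x = \<phi> (\<psi> x)"
  using assms by (simp add: AutoGroup_def BijGroup_def auto_def compose_def)

lemma one_AutoGroup: "x \<in> carrier G \<Longrightarrow> \<one>\<^bsub>AutoGroup G\<^esub> x = x"
  by (simp add: AutoGroup_def BijGroup_def)

lemma auto_closed: "\<phi> \<in> auto G \<Longrightarrow> x \<in> carrier G \<Longrightarrow> \<phi> x \<in> carrier G"
  by (auto simp: auto_def hom_def)

lemma subgroup_weight_auto: "subgroup (weight_auto n) (AutoGroup (free_group n))"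
proof -
  let ?F = "free_group n"
  interpret A: group "AutoGroup ?F"
    by (rule group.AutoGroup[OF group_free_group])
  have auto_iff: "\<phi> \<in> auto ?F \<longleftrightarrow> \<phi> \<in> carrier (AutoGroup ?F)" for \<phi>
    by (simp add: carrier_AutoGroup)
  show ?thesis
  proof (rule A.subgroupI)
    show "weight_auto n \<subseteq> carrier (AutoGroup ?F)"
      by (auto simp: weight_auto_def carrier_AutoGroup)
    have "\<one>\<^bsub>AutoGroup ?F\<^esub> \<in> weight_auto n"
      by (simp add: weight_auto_def one_AutoGroup auto_iff)
    then show "weight_auto n \<noteq> {}"
      by blast
  next
    fix \<phi>
    assume \<phi>: "\<phi> \<in> weight_auto n"
    let ?\<psi> = "inv\<^bsub>AutoGroup ?F\<^esub> \<phi>"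
    have auts: "\<phi> \<in> auto ?F" "?\<psi> \<in> auto ?F"
      using \<phi> by (simp_all add: weight_auto_def auto_iff)
    have "weight (?\<psi> w) = weight w" if w: "w \<in> carrier ?F" for w
    proof -
      have "\<phi> (?\<psi> w) = w"
        using auts w mult_AutoGroup[OF auts w] by (simp add: one_AutoGroup auto_iff)
      then show ?thesis
        using \<phi> auto_closed[OF auts(2) w] by (auto simp: weight_auto_def)
    qed
    with auts show "?\<psi> \<in> weight_auto n"
      by (simp add: weight_auto_def)
  next
    fix \<phi> \<psi>
    assume "\<phi> \<in> weight_auto n" "\<psi> \<in> weight_auto n"
    then show "\<phi> \<otimes>\<^bsub>AutoGroup ?F\<^esub> \<psi> \<in> weight_auto n"
      by (auto simp: weight_auto_def mult_AutoGroup auto_closed)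
        (simp add: auto_iff)
  qed
qed

lemma hom_letter_inverse:
  assumes \<phi>: "\<phi> \<in> hom (free_group n) (free_group n)" and j: "j \<in> {1..n}"
  shows "\<phi> (free_gen j) \<otimes>\<^bsub>free_group n\<^esub> \<phi> [(j, False)] = []"
proof -
  let ?F = "free_group n"
  have "\<phi> (free_gen j) \<otimes>\<^bsub>?F\<^esub> \<phi> [(j, False)] = \<phi> (free_gen j \<otimes>\<^bsub>?F\<^esub> [(j, False)])"
  proof (rule hom_mult[OF \<phi>, symmetric])
    show "[(j, False)] \<in> carrier ?F"
      using j by (simp add: carrier_free_group reduced_Cons)
  qed (use j in \<open>rule free_gen_carrier\<close>)
  also have "free_gen j \<otimes>\<^bsub>?F\<^esub> [(j, False)] = \<one>\<^bsub>?F\<^esub>"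
    by (simp add: mult_free_group one_free_group free_gen_def letter_inv_def)
  finally show ?thesis
    using group_hom.hom_one[of ?F ?F \<phi>] \<phi> group_free_group
    by (simp add: group_hom_def group_hom_axioms_def one_free_group)
qed

text \<open>
  The values at an inverse letter are forced by \<open>\<phi>(a\<^sub>j) \<phi>(a\<^sub>j\<^sup>-\<^sup>1) = 1\<close> and the product rule.
\<close>

lemma weight_preserving_hom_letter:
  assumes \<phi>: "\<phi> \<in> hom (free_group n) (free_group n)"
    and gen: "\<And>j. j \<in> {1..n} \<Longrightarrow> weight (\<phi> (free_gen j)) = tvar"
    and x: "fst x \<in> {1..n}"
  shows "weight (\<phi> [x]) = letter_weight x"
    and "fox (\<phi> [x]) k = letter_fox x (fst x) * fox (\<phi> (free_gen (fst x))) k"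
proof -
  obtain j e where x_eq: "x = (j, e)"
    by fastforce
  have j: "j \<in> {1..n}"
    using x x_eq by simp
  have w: "tvar * weight (\<phi> [(j, False)]) = 1"
    using arg_cong[OF hom_letter_inverse[OF \<phi> j], of weight] gen[OF j] by (simp add: weight_mult)
  have f: "fox (\<phi> (free_gen j)) k + tvar * fox (\<phi> [(j, False)]) k = 0"
    using arg_cong[OF hom_letter_inverse[OF \<phi> j], of "\<lambda>w. fox w k"] gen[OF j]
    by (simp add: fox_mult)
  have wF: "weight (\<phi> [(j, False)]) = tinv"
    using arg_cong[OF w, of "(*) tinv"] by (simp add: tvar_tinv_cancel)
  have fF: "fox (\<phi> [(j, False)]) k = - (tinv * fox (\<phi> (free_gen j)) k)"
    using arg_cong[OF f, of "(*) tinv"]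
    by (simp add: tvar_tinv_cancel distrib_left eq_neg_iff_add_eq_0 add.commute)
  show "weight (\<phi> [x]) = letter_weight x"
    using wF gen[OF j] by (cases e) (simp_all add: x_eq letter_weight_def free_gen_def)
  show "fox (\<phi> [x]) k = letter_fox x (fst x) * fox (\<phi> (free_gen (fst x))) k"
    using fF by (cases e) (simp_all add: x_eq letter_fox_def free_gen_def)
qed

text \<open>
  The second part is the chain rule. Both parts follow by splitting off the first letter: the
  coefficient that the product rule puts before the derivative of the rest of the word is the
  weight of that letter, and \<open>\<phi>\<close> does not change it.
\<close>

lemma weight_preserving_hom:
  assumes \<phi>: "\<phi> \<in> hom (free_group n) (free_group n)"
    and gen: "\<And>j. j \<in> {1..n} \<Longrightarrow> weight (\<phi> (free_gen j)) = tvar"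
    and w: "w \<in> carrier (free_group n)"
  shows "weight (\<phi> w) = weight w"
    and "fox (\<phi> w) k = (\<Sum>j = 1..n. fox (\<phi> (free_gen j)) k * fox w j)"
proof -
  let ?F = "free_group n"
  have "weight (\<phi> w) = weight w \<and>
      fox (\<phi> w) k = (\<Sum>j = 1..n. fox (\<phi> (free_gen j)) k * fox w j)"
    using w
  proof (induction w)
    case Nil
    have "\<phi> [] = []"
      using group_hom.hom_one[of ?F ?F \<phi>] \<phi> group_free_group
      by (simp add: group_hom_def group_hom_axioms_def one_free_group)
    then show ?case
      by simp
  next
    case (Cons x w)
    note xw = Cons_free_group[OF Cons.prems]
    have x: "fst x \<in> {1..n}"
      using xw(2) by (simp add: carrier_free_group)
    have letter: "weight (\<phi> [x]) = letter_weight x"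
      "fox (\<phi> [x]) k = letter_fox x (fst x) * fox (\<phi> (free_gen (fst x))) k"
      by (rule weight_preserving_hom_letter[OF \<phi>]; use gen x in simp)+
    have split: "\<phi> (x # w) = \<phi> [x] \<otimes>\<^bsub>?F\<^esub> \<phi> w"
      using xw \<phi> by (metis (no_types, lifting) hom_mult)
    \<comment> \<open>The derivative of a letter is nonzero only in its own direction.\<close>
    have "(\<Sum>j = 1..n. fox (\<phi> (free_gen j)) k * letter_fox x j) =
        (\<Sum>j = 1..n. if j = fst x then fox (\<phi> (free_gen j)) k * letter_fox x j else 0)"
      by (rule sum.cong) (simp_all add: letter_fox_def)
    also have "\<dots> = fox (\<phi> [x]) k"
      using x by (simp add: letter(2) mult.commute[of "letter_fox x (fst x)"])
    finally have "(\<Sum>j = 1..n. fox (\<phi> (free_gen j)) k * fox (x # w) j) =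
        fox (\<phi> [x]) k + letter_weight x * (\<Sum>j = 1..n. fox (\<phi> (free_gen j)) k * fox w j)"
      by (simp add: distrib_left sum.distrib sum_distrib_left mult.left_commute)
    then show ?case
      using Cons.IH xw(3) by (simp add: split weight_mult fox_mult letter(1))
  qed
  then show "weight (\<phi> w) = weight w"
    and "fox (\<phi> w) k = (\<Sum>j = 1..n. fox (\<phi> (free_gen j)) k * fox w j)"
    by simp_all
qed

section \<open>The Jacobian representation\<close>

text \<open>
  Generators are numbered from 1 and matrix rows and columns from 0, hence the successors.
\<close>

definition fox_jacobian :: "nat \<Rightarrow> (word \<Rightarrow> word) \<Rightarrow> laurent mat" where
  "fox_jacobian n \<phi> = mat n n (\<lambda>(k, j). fox (\<phi> (free_gen (Suc j))) (Suc k))"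

lemma fox_jacobian_carrier [simp]: "fox_jacobian n \<phi> \<in> carrier_mat n n"
  by (simp add: fox_jacobian_def)

lemma fox_jacobian_mult:
  assumes \<phi>: "\<phi> \<in> weight_auto n" and \<psi>: "\<psi> \<in> weight_auto n"
  shows "fox_jacobian n (\<phi> \<otimes>\<^bsub>AutoGroup (free_group n)\<^esub> \<psi>) = fox_jacobian n \<phi> * fox_jacobian n \<psi>"
    (is "?L = ?R")
proof (rule eq_matI)
  fix k j
  assume "k < dim_row ?R" "j < dim_col ?R"
  then have k: "k < n" and j: "j < n"
    by (simp_all add: fox_jacobian_def)
  have auts: "\<phi> \<in> auto (free_group n)" "\<psi> \<in> auto (free_group n)"
    using \<phi> \<psi> by (simp_all add: weight_auto_def)
  have gen: "free_gen (Suc j) \<in> carrier (free_group n)"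
    using j by (intro free_gen_carrier) simp
  have "fox (\<phi> (\<psi> (free_gen (Suc j)))) (Suc k) =
      (\<Sum>l = 1..n. fox (\<phi> (free_gen l)) (Suc k) * fox (\<psi> (free_gen (Suc j))) l)"
  proof (rule weight_preserving_hom(2))
    show "\<phi> \<in> hom (free_group n) (free_group n)"
      using auts by (simp add: auto_def)
    show "\<psi> (free_gen (Suc j)) \<in> carrier (free_group n)"
      using auts gen by (simp add: auto_closed)
  qed (use \<phi> in \<open>simp add: weight_auto_def free_gen_carrier\<close>)
  also have "\<dots> = (\<Sum>l<n. fox (\<phi> (free_gen (Suc l))) (Suc k) * fox (\<psi> (free_gen (Suc j))) (Suc l))"
    by (rule sum.reindex_bij_witness[of _ Suc "\<lambda>l. l - 1"]) auto
  finally show "?L $$ (k, j) = ?R $$ (k, j)"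
    using k j mult_AutoGroup[OF auts gen]
    by (simp add: fox_jacobian_def scalar_prod_def atLeast0LessThan)
qed (simp_all add: fox_jacobian_def)

lemma fox_jacobian_one: "fox_jacobian n \<one>\<^bsub>AutoGroup (free_group n)\<^esub> = 1\<^sub>m n"
  by (rule eq_matI) (simp_all add: fox_jacobian_def one_AutoGroup free_gen_carrier)

text \<open>
  The fundamental formula determines the column sum times \<open>t - 1\<close>, and \<open>\<int>[t\<^sup>\<plusminus>\<^sup>1]\<close> is a domain.
\<close>

lemma fox_jacobian_col_sum:
  assumes \<phi>: "\<phi> \<in> weight_auto n" and j: "j < n"
  shows "(\<Sum>k<n. fox_jacobian n \<phi> $$ (k, j)) = 1"
proof -
  have gen: "free_gen (Suc j) \<in> carrier (free_group n)"
    using j by (intro free_gen_carrier) simp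
  then have "\<phi> (free_gen (Suc j)) \<in> carrier (free_group n)"
    using \<phi> by (simp add: weight_auto_def auto_closed)
  then have "(\<Sum>k = 1..n. fox (\<phi> (free_gen (Suc j))) k) * (tvar - 1) = tvar - 1"
    using sum_fox[of "\<phi> (free_gen (Suc j))" n] \<phi> gen
    by (simp add: weight_auto_def carrier_free_group)
  then have "(\<Sum>k = 1..n. fox (\<phi> (free_gen (Suc j))) k) = 1"
    using tvar_neq_1 by simp
  moreover have "(\<Sum>k<n. fox (\<phi> (free_gen (Suc j))) (Suc k)) =
      (\<Sum>k = 1..n. fox (\<phi> (free_gen (Suc j))) k)"
    by (rule sum.reindex_bij_witness[of _ "\<lambda>l. l - 1" Suc]) auto
  ultimately show ?thesis
    using j by (simp add: fox_jacobian_def)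
qed

section \<open>Restriction to vectors with coordinate sum zero\<close>

text \<open>
  The columns \<open>e\<^sub>j - e\<^bsub>j+1\<^esub>\<close> form a basis of the vectors with coordinate sum 0, and the coordinates of such
  a vector in this basis are its partial sums. Accordingly \<open>partial_sum_mat\<close> is a left inverse of
  \<open>diff_mat\<close>, and it is a right inverse on vectors with coordinate sum 0.
\<close>

definition diff_mat :: "nat \<Rightarrow> laurent mat" where
  "diff_mat n = mat n (n - 1) (\<lambda>(k, j). if k = j then 1 else if k = Suc j then - 1 else 0)"

definition partial_sum_mat :: "nat \<Rightarrow> laurent mat" where
  "partial_sum_mat n = mat (n - 1) n (\<lambda>(k, j). if j \<le> k then 1 else 0)"

lemma diff_mat_carrier [simp]: "diff_mat n \<in> carrier_mat n (n - 1)"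
  and partial_sum_mat_carrier [simp]: "partial_sum_mat n \<in> carrier_mat (n - 1) n"
  by (simp_all add: diff_mat_def partial_sum_mat_def)

lemma mult_diff_mat:
  assumes X: "X \<in> carrier_mat m n" and k: "k < m" and j: "j < n - 1"
  shows "(X * diff_mat n) $$ (k, j) = X $$ (k, j) - X $$ (k, Suc j)"
proof -
  have "(X * diff_mat n) $$ (k, j) =
      (\<Sum>l<n. X $$ (k, l) * (if l = j then 1 else if l = Suc j then - 1 else 0))"
    using assms by (simp add: diff_mat_def scalar_prod_def atLeast0LessThan)
  also have "\<dots> = (\<Sum>l<n. (if l = j then X $$ (k, l) else 0) - (if l = Suc j then X $$ (k, l) else 0))"
    by (rule sum.cong) auto
  also have "\<dots> = X $$ (k, j) - X $$ (k, Suc j)"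
    using j less_diff_conv[of j n 1] by (simp add: sum_subtractf)
  finally show ?thesis .
qed

lemma partial_sum_mat_mult:
  assumes X: "X \<in> carrier_mat n m" and k: "k < n - 1" and j: "j < m"
  shows "(partial_sum_mat n * X) $$ (k, j) = (\<Sum>l\<le>k. X $$ (l, j))"
proof -
  have "(partial_sum_mat n * X) $$ (k, j) = (\<Sum>l<n. if l \<le> k then X $$ (l, j) else 0)"
    using assms by (auto simp: partial_sum_mat_def scalar_prod_def atLeast0LessThan intro!: sum.cong)
  also have "\<dots> = (\<Sum>l\<in>{l \<in> {..<n}. l \<le> k}. X $$ (l, j))"
    by (rule sum.inter_filter[symmetric]) simp
  also have "{l \<in> {..<n}. l \<le> k} = {..k}"
    using k by auto
  finally show ?thesis .
qed

lemma partial_sum_diff_mat: "partial_sum_mat n * diff_mat n = 1\<^sub>m (n - 1)" (is "?L = _")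
proof (rule eq_matI)
  fix k j
  assume "k < dim_row (1\<^sub>m (n - 1) :: laurent mat)" "j < dim_col (1\<^sub>m (n - 1) :: laurent mat)"
  then have "k < n - 1" "j < n - 1" "j < n" "Suc j < n"
    by auto
  then show "?L $$ (k, j) = 1\<^sub>m (n - 1) $$ (k, j)"
    using mult_diff_mat[of "partial_sum_mat n" "n - 1" n k j] by (auto simp: partial_sum_mat_def)
qed (simp_all add: diff_mat_def partial_sum_mat_def)

lemma diff_partial_sum_mat:
  assumes X: "X \<in> carrier_mat n m" and zero: "\<And>j. j < m \<Longrightarrow> (\<Sum>k<n. X $$ (k, j)) = 0"
  shows "diff_mat n * (partial_sum_mat n * X) = X"
proof (rule eq_matI)
  fix k j
  assume "k < dim_row X" "j < dim_col X"
  then have k: "k < n" and j: "j < m"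
    using X by auto
  define Y where "Y = partial_sum_mat n * X"
  have Y: "Y \<in> carrier_mat (n - 1) m"
    unfolding Y_def by (rule mult_carrier_mat[OF partial_sum_mat_carrier X])
  have Y_entry: "Y $$ (l, j) = (\<Sum>i\<le>l. X $$ (i, j))" if "l < n - 1" for l
    unfolding Y_def using partial_sum_mat_mult[OF X that j] .
  have "(diff_mat n * Y) $$ (k, j) =
      (\<Sum>l<n - 1. (if k = l then 1 else if k = Suc l then - 1 else 0) * Y $$ (l, j))"
    using Y k j by (simp add: diff_mat_def scalar_prod_def atLeast0LessThan)
  also have "\<dots> = (\<Sum>l<n - 1. (if l = k then Y $$ (l, j) else 0)
      - (if k = Suc l then Y $$ (l, j) else 0))"
    by (rule sum.cong) auto
  also have "\<dots> = (if k < n - 1 then Y $$ (k, j) else 0)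
      - (\<Sum>l<n - 1. if k = Suc l then Y $$ (l, j) else 0)"
    by (simp add: sum_subtractf)
  also have "(\<Sum>l<n - 1. if k = Suc l then Y $$ (l, j) else 0) =
      (if k = 0 then 0 else Y $$ (k - 1, j))"
    using k by (cases k) simp_all
  also have "(if k < n - 1 then Y $$ (k, j) else 0) = (\<Sum>i\<le>k. X $$ (i, j))"
  proof (cases "k < n - 1")
    case False
    then have "n = Suc k"
      using k by simp
    \<comment> \<open>In the last row the missing partial sum is the full column sum, which vanishes.\<close>
    with zero[OF j] show ?thesis
      by (simp add: lessThan_Suc_atMost)
  qed (simp add: Y_entry)
  also have "(\<Sum>i\<le>k. X $$ (i, j)) - (if k = 0 then 0 else Y $$ (k - 1, j)) = X $$ (k, j)"
    using k by (cases k) (simp_all add: Y_entry)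
  finally show "(diff_mat n * (partial_sum_mat n * X)) $$ (k, j) = X $$ (k, j)"
    by (simp add: Y_def)
qed (use X in \<open>simp_all add: diff_mat_def\<close>)

text \<open>
  The matrix of the Jacobian on vectors with coordinate sum 0, in the basis \<open>e\<^sub>j - e\<^bsub>j+1\<^esub>\<close>.
\<close>

definition reduced_jacobian :: "nat \<Rightarrow> (word \<Rightarrow> word) \<Rightarrow> laurent mat" where
  "reduced_jacobian n \<phi> = partial_sum_mat n * (fox_jacobian n \<phi> * diff_mat n)"

lemma reduced_jacobian_carrier [simp]: "reduced_jacobian n \<phi> \<in> carrier_mat (n - 1) (n - 1)"
  by (auto simp: reduced_jacobian_def fox_jacobian_def diff_mat_def partial_sum_mat_def)

text \<open>
  Since all columns of the Jacobian have the same sum, it sends \<open>e\<^sub>j - e\<^bsub>j+1\<^esub>\<close> to a vector with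
  coordinate sum 0, which is recovered from its partial sums.
\<close>

lemma diff_mat_intertwines:
  assumes "\<phi> \<in> weight_auto n"
  shows "diff_mat n * reduced_jacobian n \<phi> = fox_jacobian n \<phi> * diff_mat n"
  unfolding reduced_jacobian_def
proof (rule diff_partial_sum_mat)
  show "fox_jacobian n \<phi> * diff_mat n \<in> carrier_mat n (n - 1)"
    by (rule mult_carrier_mat[OF fox_jacobian_carrier diff_mat_carrier])
  fix j
  assume j: "j < n - 1"
  have "(\<Sum>k<n. (fox_jacobian n \<phi> * diff_mat n) $$ (k, j)) =
      (\<Sum>k<n. fox_jacobian n \<phi> $$ (k, j)) - (\<Sum>k<n. fox_jacobian n \<phi> $$ (k, Suc j))"
    by (simp add: mult_diff_mat[OF fox_jacobian_carrier _ j] sum_subtractf)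
  also have "\<dots> = 0"
    using assms j by (simp add: fox_jacobian_col_sum)
  finally show "(\<Sum>k<n. (fox_jacobian n \<phi> * diff_mat n) $$ (k, j)) = 0" .
qed

lemma reduced_jacobian_mult:
  assumes \<phi>: "\<phi> \<in> weight_auto n" and \<psi>: "\<psi> \<in> weight_auto n"
  shows "reduced_jacobian n (\<phi> \<otimes>\<^bsub>AutoGroup (free_group n)\<^esub> \<psi>) =
    reduced_jacobian n \<phi> * reduced_jacobian n \<psi>"
proof -
  let ?J = "fox_jacobian n" and ?K = "reduced_jacobian n"
  let ?P = "diff_mat n" and ?Q = "partial_sum_mat n"
  have "?J (\<phi> \<otimes>\<^bsub>AutoGroup (free_group n)\<^esub> \<psi>) * ?P = ?J \<phi> * (?J \<psi> * ?P)"
    using fox_jacobian_mult[OF \<phi> \<psi>]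
      assoc_mult_mat[OF fox_jacobian_carrier fox_jacobian_carrier diff_mat_carrier] by simp
  also have "\<dots> = ?J \<phi> * (?P * ?K \<psi>)"
    by (simp add: diff_mat_intertwines[OF \<psi>])
  also have "\<dots> = (?J \<phi> * ?P) * ?K \<psi>"
    using assoc_mult_mat[OF fox_jacobian_carrier diff_mat_carrier reduced_jacobian_carrier] by simp
  finally show ?thesis
    using assoc_mult_mat[OF partial_sum_mat_carrier
        mult_carrier_mat[OF fox_jacobian_carrier diff_mat_carrier] reduced_jacobian_carrier]
    by (simp add: reduced_jacobian_def)
qed

lemma reduced_jacobian_one: "reduced_jacobian n \<one>\<^bsub>AutoGroup (free_group n)\<^esub> = 1\<^sub>m (n - 1)"
  using left_mult_one_mat[OF diff_mat_carrier]
  by (simp add: reduced_jacobian_def fox_jacobian_one partial_sum_diff_mat)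

text \<open>
  A monoid homomorphism out of a group takes values in the units. This makes it unnecessary to
  exhibit inverse matrices.
\<close>

lemma hom_units_of:
  assumes "group G" and "f \<in> hom G M" and "f \<one>\<^bsub>G\<^esub> = \<one>\<^bsub>M\<^esub>"
  shows "f \<in> hom G (units_of M)"
proof -
  interpret group G by fact
  have "f x \<in> Units M" if x: "x \<in> carrier G" for x
  proof -
    have "f (inv\<^bsub>G\<^esub> x) \<otimes>\<^bsub>M\<^esub> f x = \<one>\<^bsub>M\<^esub>" "f x \<otimes>\<^bsub>M\<^esub> f (inv\<^bsub>G\<^esub> x) = \<one>\<^bsub>M\<^esub>"
      using assms(2,3) x by (simp_all flip: hom_mult[OF assms(2)])
    then show ?thesis
      using assms(2) x by (auto simp: Units_def intro: hom_in_carrier)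
  qed
  then show ?thesis
    using assms(2) by (auto simp: hom_def units_of_def)
qed

section \<open>The block matrices entry by entry\<close>

lemma diag_block_mat_index:
  assumes A: "A \<in> carrier_mat m m" and k: "k < a + m + b" and j: "j < a + m + b"
  shows "diag_block_mat [1\<^sub>m a, A, 1\<^sub>m b] $$ (k, j) =
    (if k \<in> {a..<a + m} \<and> j \<in> {a..<a + m} then A $$ (k - a, j - a) else if k = j then 1 else 0)"
  using assms by (auto simp: Let_def four_block_mat_def)

lemma block_2_carrier:
  assumes "A \<in> carrier_mat 2 2" and "i \<in> {1..<n}"
  shows "block_2 n i A \<in> carrier_mat n n"
  using assms by (auto simp: block_2_def dim_diag_block_mat intro!: carrier_matI)

lemma block_2_index:
  assumes A: "A \<in> carrier_mat 2 2" and i: "i \<in> {1..<n}" and "k < n" "j < n"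
  shows "block_2 n i A $$ (k, j) =
    (if k \<in> {i - 1, i} \<and> j \<in> {i - 1, i} then A $$ (Suc k - i, Suc j - i)
     else if k = j then 1 else 0)"
proof -
  have window: "{i - 1..<i - 1 + 2} = {i - 1, i}" and size: "i - 1 + 2 + (n - i - 1) = n"
    using i by auto
  have offset: "l - (i - 1) = Suc l - i" for l
    using i by auto
  show ?thesis
    using diag_block_mat_index[OF A, of k "i - 1" "n - i - 1" j] \<open>k < n\<close> \<open>j < n\<close>
    unfolding block_2_def window size offset by blast
qed

lemma block_3_carrier:
  assumes "A \<in> carrier_mat 3 3" and "i \<in> {1..<n}"
  shows "block_3 n i A \<in> carrier_mat (n - 1) (n - 1)"
  using assms by (auto simp: block_3_def Let_def dim_diag_block_mat mat_delete_def intro!: carrier_matI)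

text \<open>
  The \<open>3 \<times> 3\<close> window starts at row \<open>i - 2\<close>. If \<open>i = 1\<close>, this is row \<open>-1\<close>, and the deletion of the top row
  shifts the entries of the block by one. So the same index \<open>k + 2 - i\<close> into the block is correct
  with and without truncation.
\<close>

lemma block_3_index:
  assumes A: "A \<in> carrier_mat 3 3" and i: "i \<in> {1..<n}" and k: "k < n - 1" and j: "j < n - 1"
  shows "block_3 n i A $$ (k, j) =
    (if Suc k \<in> {i - 1..i + 1} \<and> Suc j \<in> {i - 1..i + 1} then A $$ (k + 2 - i, j + 2 - i)
     else if k = j then 1 else 0)"
proof -
  define B where "B = (if i = n - 1 then mat_delete A 2 2 else A)"
  define C where "C = (if i = 1 then mat_delete B 0 0 else B)"
  \<comment> \<open>The numbers of rows deleted at the top and at the bottom of the block.\<close>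
  define p where "p = (if i = 1 then 1 else 0 :: nat)"
  define q where "q = (if i = n - 1 then 1 else 0 :: nat)"
  have C: "C \<in> carrier_mat (3 - q - p) (3 - q - p)"
    using A by (auto simp: B_def C_def p_def q_def mat_delete_def)
  have C_entry: "C $$ (x, y) = A $$ (x + p, y + p)" if "x < 3 - q - p" "y < 3 - q - p" for x y
    using A that by (auto simp: B_def C_def p_def q_def mat_delete_def)
  have size: "i - 2 + (3 - q - p) + (n - i - 2) = n - 1"
    using i by (auto simp: p_def q_def)
  have window: "l \<in> {i - 2..<i - 2 + (3 - q - p)} \<longleftrightarrow> Suc l \<in> {i - 1..i + 1}" if "l < n - 1" for l
    using i that by (auto simp: p_def q_def)
  have offset: "l - (i - 2) + p = l + 2 - i" if "Suc l \<in> {i - 1..i + 1}" for l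
    using i that by (auto simp: p_def)
  have "block_3 n i A $$ (k, j) = diag_block_mat [1\<^sub>m (i - 2), C, 1\<^sub>m (n - i - 2)] $$ (k, j)"
    by (simp add: block_3_def B_def C_def)
  also have "\<dots> = (if Suc k \<in> {i - 1..i + 1} \<and> Suc j \<in> {i - 1..i + 1}
      then C $$ (k - (i - 2), j - (i - 2)) else if k = j then 1 else 0)"
    using diag_block_mat_index[OF C, of k "i - 2" "n - i - 2" j] k j
    by (simp only: size window)
  finally have "block_3 n i A $$ (k, j) = \<dots>" .
  moreover have "C $$ (k - (i - 2), j - (i - 2)) = A $$ (k + 2 - i, j + 2 - i)"
    if "Suc k \<in> {i - 1..i + 1}" "Suc j \<in> {i - 1..i + 1}"
  proof -
    have "l - (i - 2) < 3 - q - p" if "Suc l \<in> {i - 1..i + 1}" "l < n - 1" for l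
      using window[OF that(2)] that(1) by auto
    then show ?thesis
      using that k j by (simp only: C_entry offset)
  qed
  ultimately show ?thesis
    by auto
qed

lemma block_3_row_index:
  assumes "i \<in> {1..<n}" and "k < n - 1" and "j < n - 1"
  shows "block_3 n i (mat_of_rows_list 3 [[1, 0, 0], [a, b, c], [0, 0, 1]]) $$ (k, j) =
    (if Suc k = i then if Suc j = k then a else if j = k then b else if j = i then c else 0
     else if k = j then 1 else 0)" (is "block_3 n i ?A $$ _ = _")
proof -
  have A: "?A \<in> carrier_mat 3 3"
    by (auto simp: mat_of_rows_list_def)
  have entry: "?A $$ (x, y) =
      (if x = 1 then if y = 0 then a else if y = 1 then b else c else if x = y then 1 else 0)"
    if "x < 3" "y < 3" for x y
    using that
    by (auto simp: mat_of_rows_list_def numeral_3_eq_3 less_Suc_eq)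
  have range: "l + 2 - i < 3" "l + 2 - i = 0 \<longleftrightarrow> Suc (Suc l) = i" "l + 2 - i = 1 \<longleftrightarrow> Suc l = i"
    if "Suc l \<in> {i - 1..i + 1}" for l
    using that assms(1) by auto
  have inj: "k + 2 - i = j + 2 - i \<longleftrightarrow> k = j"
    if "Suc k \<in> {i - 1..i + 1}" "Suc j \<in> {i - 1..i + 1}"
    using that assms(1) by auto
  show ?thesis
  proof (cases "Suc k \<in> {i - 1..i + 1} \<and> Suc j \<in> {i - 1..i + 1}")
    case True
    then have "block_3 n i ?A $$ (k, j) = ?A $$ (k + 2 - i, j + 2 - i)"
      using block_3_index[OF A assms] by (simp only: simp_thms if_True)
    also have "\<dots> = (if Suc k = i then if Suc (Suc j) = i then a else if Suc j = i then b else c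
        else if k = j then 1 else 0)"
      using True by (simp only: entry range inj)
    finally show ?thesis
      using True by auto
  next
    case False
    then have "block_3 n i ?A $$ (k, j) = (if k = j then 1 else 0)"
      using block_3_index[OF A assms] by (simp only: simp_thms if_False)
    then show ?thesis
      using False by auto
  qed
qed

section \<open>The images of the generators\<close>

text \<open>
  The derivative of the image of \<open>a\<^sub>j\<close> in direction \<open>a\<^sub>k\<close> under \<open>\<sigma>\<^sub>i\<close> if \<open>s = t\<close>, and under \<open>\<tau>\<^sub>i\<close> if \<open>s = 1\<close>. The
  Burau matrices become those of \<open>\<tau>\<^sub>i\<close> in the same way, which allows both to be treated at once.
\<close>

definition exchange_fox :: "nat \<Rightarrow> laurent \<Rightarrow> nat \<Rightarrow> nat \<Rightarrow> laurent" where
  "exchange_fox i s j k =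
    (if j = i then if k = i then 1 - s else if k = i + 1 then s else 0
     else if k = (if j = i + 1 then i else j) then 1 else 0)"

lemma fox_jacobian_exchange:
  assumes i: "i \<in> {1..<n}"
    and \<phi>: "\<And>j k. j \<in> {1..n} \<Longrightarrow> fox (\<phi> (free_gen j)) k = exchange_fox i s j k"
  shows "fox_jacobian n \<phi> = block_2 n i (mat_of_rows_list 2 [[1 - s, 1], [s, 0]])"
    (is "_ = block_2 n i ?A")
proof -
  have A: "?A \<in> carrier_mat 2 2"
    by (auto simp: mat_of_rows_list_def)
  note C = block_2_carrier[OF A i]
  show ?thesis
  proof (rule eq_matI)
    fix k j
    assume "k < dim_row (block_2 n i ?A)" "j < dim_col (block_2 n i ?A)"
    then have kj: "k < n" "j < n"
      using C by auto
    show "fox_jacobian n \<phi> $$ (k, j) = block_2 n i ?A $$ (k, j)"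
    proof -
      obtain p where p: "i = Suc p"
        using i by (cases i) auto
      have "fox_jacobian n \<phi> $$ (k, j) = exchange_fox i s (Suc j) (Suc k)"
        using kj \<phi> by (simp add: fox_jacobian_def)
      also have "\<dots> = block_2 n i ?A $$ (k, j)"
        unfolding block_2_index[OF A i kj] unfolding p
        by (cases "k = p"; cases "k = Suc p"; cases "j = p"; cases "j = Suc p")
          (simp_all add: mat_of_rows_list_def exchange_fox_def)
      finally show ?thesis .
    qed
  qed (simp_all only: carrier_matD[OF C] carrier_matD[OF fox_jacobian_carrier])
qed

text \<open>
  Partial sums of columns of the Jacobian. Differences of consecutive ones are the entries of the
  reduced matrix.
\<close>

lemma sum_exchange_fox:
  assumes i: "1 \<le> i"
  shows "(\<Sum>l\<le>k. exchange_fox i s (Suc j) (Suc l)) =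
    (if Suc j = i then if k < j then 0 else if k = j then 1 - s else 1
     else if (if j = i then i - 1 else j) \<le> k then 1 else 0)"
proof (cases "Suc j = i")
  case True
  have "(\<Sum>l\<le>k. exchange_fox i s (Suc j) (Suc l)) =
      (\<Sum>l\<le>k. (if l = j then 1 - s else 0) + (if l = Suc j then s else 0))"
    using True by (intro sum.cong) (auto simp: exchange_fox_def)
  then show ?thesis
    using True by (auto simp: sum.distrib)
next
  case False
  have "(\<Sum>l\<le>k. exchange_fox i s (Suc j) (Suc l)) =
      (\<Sum>l\<le>k. if l = (if j = i then i - 1 else j) then 1 else 0)"
    using False i by (intro sum.cong) (auto simp: exchange_fox_def)
  then show ?thesis
    using False by simp
qed

lemma reduced_jacobian_exchange:
  assumes i: "i \<in> {1..<n}"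
    and \<phi>: "\<And>j k. j \<in> {1..n} \<Longrightarrow> fox (\<phi> (free_gen j)) k = exchange_fox i s j k"
  shows "reduced_jacobian n \<phi> =
    block_3 n i (mat_of_rows_list 3 [[1, 0, 0], [s, - s, 1], [0, 0, 1]])" (is "_ = block_3 n i ?A")
proof -
  have A: "?A \<in> carrier_mat 3 3"
    by (auto simp: mat_of_rows_list_def)
  note C = block_3_carrier[OF A i]
  show ?thesis
  proof (rule eq_matI)
    fix k j
    assume "k < dim_row (block_3 n i ?A)" "j < dim_col (block_3 n i ?A)"
    then have k: "k < n - 1" and j: "j < n - 1"
      using C by auto
    have entry: "fox_jacobian n \<phi> $$ (l, m) = exchange_fox i s (Suc m) (Suc l)"
      if "l < n" "m < n" for l m
      using that \<phi> by (simp add: fox_jacobian_def)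
    have "reduced_jacobian n \<phi> $$ (k, j) = (\<Sum>l\<le>k. (fox_jacobian n \<phi> * diff_mat n) $$ (l, j))"
      unfolding reduced_jacobian_def
      by (rule partial_sum_mat_mult[OF mult_carrier_mat[OF fox_jacobian_carrier diff_mat_carrier] k j])
    also have "\<dots> = (\<Sum>l\<le>k. exchange_fox i s (Suc j) (Suc l) - exchange_fox i s (Suc (Suc j)) (Suc l))"
    proof (rule sum.cong[OF refl])
      fix l
      assume "l \<in> {..k}"
      with k j show "(fox_jacobian n \<phi> * diff_mat n) $$ (l, j) =
          exchange_fox i s (Suc j) (Suc l) - exchange_fox i s (Suc (Suc j)) (Suc l)"
        by (simp add: mult_diff_mat[OF fox_jacobian_carrier] entry)
    qed
    also have "\<dots> = block_3 n i ?A $$ (k, j)"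
      using i by (auto simp: sum_subtractf sum_exchange_fox block_3_row_index[OF i k j])
    finally show "reduced_jacobian n \<phi> $$ (k, j) = block_3 n i ?A $$ (k, j)" .
  qed (simp_all only: carrier_matD[OF C] carrier_matD[OF reduced_jacobian_carrier])
qed

lemma lb_tau_gen:
  assumes i: "i \<in> {1..<n}" and j: "j \<in> {1..n}"
  shows "lb_tau n i (free_gen j) = free_gen (if j = i then i + 1 else if j = i + 1 then i else j)"
  unfolding lb_tau_def using i j by (subst free_endo_gen) (auto intro!: free_gen_carrier)

lemma lb_sigma_gen:
  assumes i: "i \<in> {1..<n}" and j: "j \<in> {1..n}"
  shows "lb_sigma n i (free_gen j) =
    (if j = i then free_gen i \<otimes>\<^bsub>free_group n\<^esub> free_gen (i + 1) \<otimes>\<^bsub>free_group n\<^esub> [(i, False)]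
     else free_gen (if j = i + 1 then i else j))"
proof -
  interpret group "free_group n"
    by (rule group_free_group)
  have "free_gen i \<in> carrier (free_group n)" "free_gen (i + 1) \<in> carrier (free_group n)"
    "free_gen j \<in> carrier (free_group n)" "[(i, False)] \<in> carrier (free_group n)" "i \<in> {1..n}"
    using i j by (auto simp: free_gen_def carrier_free_group reduced_Cons)
  then show ?thesis
    unfolding lb_sigma_def using j by (subst free_endo_gen) (auto simp: inv_free_gen)
qed

lemma weight_lb_tau:
  "i \<in> {1..<n} \<Longrightarrow> j \<in> {1..n} \<Longrightarrow> weight (lb_tau n i (free_gen j)) = tvar"
  by (simp add: lb_tau_gen)

lemma fox_lb_tau:
  "i \<in> {1..<n} \<Longrightarrow> j \<in> {1..n} \<Longrightarrow> fox (lb_tau n i (free_gen j)) k = exchange_fox i 1 j k"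
  by (simp add: lb_tau_gen exchange_fox_def)

lemma weight_lb_sigma:
  "i \<in> {1..<n} \<Longrightarrow> j \<in> {1..n} \<Longrightarrow> weight (lb_sigma n i (free_gen j)) = tvar"
  by (simp add: lb_sigma_gen weight_mult letter_weight_def mult.assoc tvar_tinv)

lemma fox_lb_sigma:
  "i \<in> {1..<n} \<Longrightarrow> j \<in> {1..n} \<Longrightarrow> fox (lb_sigma n i (free_gen j)) k = exchange_fox i tvar j k"
  by (simp add: lb_sigma_gen fox_mult weight_mult letter_weight_def letter_fox_def exchange_fox_def
      mult.assoc tvar_tinv)

lemma carrier_loop_braid_group: "carrier (loop_braid_group n) \<subseteq> weight_auto n"
proof -
  let ?F = "free_group n"
  interpret group "AutoGroup ?F"
    by (rule group.AutoGroup[OF group_free_group])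
  have "\<phi> \<in> weight_auto n"
    if "\<phi> \<in> auto ?F" and "\<phi> \<in> lb_tau n ` {1..<n} \<union> lb_sigma n ` {1..<n}" for \<phi>
  proof -
    have "weight (\<phi> (free_gen j)) = tvar" if "j \<in> {1..n}" for j
      using that \<open>\<phi> \<in> lb_tau n ` {1..<n} \<union> lb_sigma n ` {1..<n}\<close>
      by (elim UnE imageE) (simp_all add: weight_lb_tau weight_lb_sigma)
    then show ?thesis
      using \<open>\<phi> \<in> auto ?F\<close> weight_preserving_hom(1)[of \<phi> n] by (simp add: weight_auto_def auto_def)
  qed
  then show ?thesis
    unfolding loop_braid_group_def carrier_subgroup_generated
    by (intro generate_subgroup_incl subgroup_weight_auto) (auto simp: carrier_AutoGroup)
qed

lemma loop_braid_group_hom: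
  assumes mult: "\<And>\<phi> \<psi>. \<lbrakk>\<phi> \<in> weight_auto n; \<psi> \<in> weight_auto n\<rbrakk> \<Longrightarrow>
      f (\<phi> \<otimes>\<^bsub>AutoGroup (free_group n)\<^esub> \<psi>) = f \<phi> * f \<psi>"
    and one: "f \<one>\<^bsub>AutoGroup (free_group n)\<^esub> = 1\<^sub>m m"
    and closed: "\<And>\<phi>. f \<phi> \<in> carrier_mat m m"
  shows "f \<in> hom (loop_braid_group n) (GL m)"
  unfolding GL_def
proof (rule hom_units_of)
  show "group (loop_braid_group n)"
    unfolding loop_braid_group_def
    by (rule group.group_subgroup_generated[OF group.AutoGroup[OF group_free_group]])
  show "f \<in> hom (loop_braid_group n) (ring_mat TYPE(laurent) m ())"
    using carrier_loop_braid_group[of n] mult closed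
    by (auto simp: hom_def ring_mat_def loop_braid_group_def subset_iff)
  show "f \<one>\<^bsub>loop_braid_group n\<^esub> = \<one>\<^bsub>ring_mat TYPE(laurent) m ()\<^esub>"
    by (simp add: one ring_mat_def loop_braid_group_def)
qed

theorem theorem1:
  fixes n :: nat
  assumes "n \<ge> 1"
  shows
    "(\<exists>\<rho> \<in> hom (loop_braid_group n) (GL n).
        (\<forall>i\<in>{1..<n}. \<rho> (lb_tau n i) = unreduced_tau n i \<and>
                     \<rho> (lb_sigma n i) = unreduced_sigma n i) \<and>
        (\<forall>\<iota>. is_braid_inclusion n \<iota> \<longrightarrow> is_unreduced_burau n (\<rho> \<circ> \<iota>))) \<and>
     (\<exists>\<rho> \<in> hom (loop_braid_group n) (GL (n - 1)).
        (\<forall>i\<in>{1..<n}. \<rho> (lb_tau n i) = reduced_tau n i \<and>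
                     \<rho> (lb_sigma n i) = reduced_sigma n i) \<and>
        (\<forall>\<iota>. is_braid_inclusion n \<iota> \<longrightarrow> is_reduced_burau n (\<rho> \<circ> \<iota>)))"
proof (intro conjI bexI)
  show J: "fox_jacobian n \<in> hom (loop_braid_group n) (GL n)"
    by (rule loop_braid_group_hom) (simp_all add: fox_jacobian_mult fox_jacobian_one)
  show J_gens: "\<forall>i\<in>{1..<n}. fox_jacobian n (lb_tau n i) = unreduced_tau n i \<and>
      fox_jacobian n (lb_sigma n i) = unreduced_sigma n i"
  proof (intro ballI conjI)
    fix i
    assume i: "i \<in> {1..<n}"
    show "fox_jacobian n (lb_tau n i) = unreduced_tau n i"
      using fox_jacobian_exchange[OF i fox_lb_tau[OF i]] by (simp add: unreduced_tau_def)
    show "fox_jacobian n (lb_sigma n i) = unreduced_sigma n i"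
      using fox_jacobian_exchange[OF i fox_lb_sigma[OF i]] by (simp add: unreduced_sigma_def)
  qed
  show "\<forall>\<iota>. is_braid_inclusion n \<iota> \<longrightarrow> is_unreduced_burau n (fox_jacobian n \<circ> \<iota>)"
    using J J_gens
    by (auto simp: is_braid_inclusion_def is_unreduced_burau_def mon_def intro: Group.hom_compose)
  show K: "reduced_jacobian n \<in> hom (loop_braid_group n) (GL (n - 1))"
    by (rule loop_braid_group_hom) (simp_all add: reduced_jacobian_mult reduced_jacobian_one
        flip: One_nat_def)
  show K_gens: "\<forall>i\<in>{1..<n}. reduced_jacobian n (lb_tau n i) = reduced_tau n i \<and>
      reduced_jacobian n (lb_sigma n i) = reduced_sigma n i"
  proof (intro ballI conjI)
    fix i
    assume i: "i \<in> {1..<n}"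
    show "reduced_jacobian n (lb_tau n i) = reduced_tau n i"
      using reduced_jacobian_exchange[OF i fox_lb_tau[OF i]] by (simp add: reduced_tau_def)
    show "reduced_jacobian n (lb_sigma n i) = reduced_sigma n i"
      using reduced_jacobian_exchange[OF i fox_lb_sigma[OF i]] by (simp add: reduced_sigma_def)
  qed
  show "\<forall>\<iota>. is_braid_inclusion n \<iota> \<longrightarrow> is_reduced_burau n (reduced_jacobian n \<circ> \<iota>)"
    using K K_gens
    by (auto simp: is_braid_inclusion_def is_reduced_burau_def mon_def intro: Group.hom_compose)
qed

end
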